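(* Let $n$ and $k$ be positive integers such that either (1) $k$ is even, $4 \mid kn$ and $n \ge k/2+2$, or (2) $k$ is odd and $k \mid n$. Then the upper bound $f(n,k,0)\le \frac{n}{k}\lfloor \frac{k^2}{4}\rfloor + n+1$ is attained, i.e. $$ f(n,k,0) = \frac{n}{k} \left\lfloor \frac{k^2}{4} \right\rfloor + n + 1. $$
   Context: Let $[n]=\{1,\dots,n\}$. For non-negative integers $k,\lambda$, a family (set of distinct subsets) $\mathcal{F}\subset 2^{[n]}$ is called $k$-almost $\lambda$-Fisher if for every $F\in\mathcal{F}$ there are at most $k$ other sets $F'\in\mathcal{F}\setminus\{F\}$ with $|F\cap F'|\neq\lambda$. Define $f(n,k,\lambda)=\max\{|\mathcal{F}| : \mathcal{F}\subset 2^{[n]} \text{ is a } k\text{-almost } \lambda\text{-Fisher family}\}$. The empty set is allowed as a member of $\mathcal{F}$. *)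

theory Defs
  imports Complex_Main
begin

definition almost_Fisher :: "nat \<Rightarrow> nat \<Rightarrow> nat \<Rightarrow> nat set set \<Rightarrow> bool" where
  "almost_Fisher n k l \<F> \<longleftrightarrow>
     \<F> \<subseteq> Pow {1..n} \<and>
     (\<forall>F\<in>\<F>. card {F' \<in> \<F> - {F}. card (F \<inter> F') \<noteq> l} \<le> k)"

definition max_almost_Fisher :: "nat \<Rightarrow> nat \<Rightarrow> nat \<Rightarrow> nat" where
  "max_almost_Fisher n k l = Max {card \<F> | \<F>. almost_Fisher n k l \<F>}"

(* Max is meaningful: it is taken over a finite nonempty set. *)

lemma finite_almost_Fisher: "finite {\<F>. almost_Fisher n k l \<F>}"
  by (rule finite_subset[of _ "Pow (Pow {1..n})"]) (auto simp: almost_Fisher_def)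

lemma finite_card_almost_Fisher: "finite {card \<F> | \<F>. almost_Fisher n k l \<F>}"
  using finite_almost_Fisher[of n k l] by simp

lemma card_almost_Fisher_nonempty: "{card \<F> | \<F>. almost_Fisher n k l \<F>} \<noteq> {}"
proof -
  have "almost_Fisher n k l {}"
    by (simp add: almost_Fisher_def)
  then show ?thesis
    by blast
qed

end

theory Submission
  imports Defs
begin

text \<open>
  Write \<open>c = \<lfloor>k\<^sup>2 / 4\<rfloor>\<close>. The empty set meets nothing, so the point is that a family \<open>\<A>\<close> of nonempty
  subsets of an \<open>n\<close>-set \<open>X\<close>, each of which meets at most \<open>k\<close> others, has at most \<open>n + (c / k) n\<close>
  members (\<open>nonempty_family_bound\<close>), and that this is attained.

  Two reductions simplify \<open>\<A>\<close>. A member may be replaced by any nonempty subset of it that is not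
  yet a member, since this only destroys intersections; so \<open>\<A>\<close> may be taken closed under nonempty
  subsets. A nonempty \<open>S \<subseteq> X\<close> may be deleted, together with all members meeting it, if there are
  at most \<open>(1 + c / k) |S|\<close> of these; induction then handles the rest. When neither reduction
  applies, all singletons are members. There is no member of size at least 4, since such a set is
  met by at most \<open>k + 1\<close> members, few enough for it to be deleted; and each member of size 3 is
  met by at least 10 members.

  If only edges (2-sets) remain besides the singletons, an edge \<open>xy\<close> satisfies
  \<open>d(x) + d(y) \<le> k\<close>. Summing over the \<open>N\<close> edges gives \<open>\<Sum> d\<^sup>2 \<le> k N\<close>, while
  \<open>d\<^sup>2 - k d + c \<ge> 0\<close> for every integer \<open>d\<close> and \<open>\<Sum> d = 2 N\<close>; together \<open>k N \<le> c n\<close>. Triples are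
  incorporated by giving each set \<open>F\<close> of size 2 or 3 the weight \<open>6 / |F|\<close>, which is three times its
  expected contribution to the degree of one of its points when \<open>F\<close> is replaced by a random pair
  inside it. Then \<open>\<Sum>\<^sub>x b(x)\<^sup>2\<close> for the weighted degree \<open>b\<close> is a sum over ordered
  pairs of members, and it exceeds 9 times the number of intersecting pairs by a controlled amount:
  9 per edge, and at most 12 per triple (\<open>charge_sum\<close>), the latter because the members meeting a triple
  without lying inside it contribute negatively and there are at least three of them. The quadratic
  inequality survives with a small loss for points in triples (\<open>quadratic_bound\<close>), and the
  estimates balance in \<open>irreducible_bound\<close>.

  The bound is attained by the empty set, all singletons, and the edges of a graph in which the two ends of
  each edge have degrees summing to at most \<open>k\<close> (\<open>graph_attains\<close>): a \<open>k / 2\<close>-regular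
  circulant graph for even \<open>k\<close>, and disjoint copies of the complete bipartite graph with parts
  of sizes \<open>(k - 1) / 2\<close> and \<open>(k + 1) / 2\<close> for odd \<open>k\<close>.
\<close>

section \<open>Weighted degrees and intersecting pairs\<close>

text \<open>The members of a family that meet a given set, including the set itself if it is a nonempty
  member.\<close>

definition touching :: "'a set set \<Rightarrow> 'a set \<Rightarrow> 'a set set" where
  "touching \<A> S = {G \<in> \<A>. G \<inter> S \<noteq> {}}"

text \<open>The weight \<open>6 / |F|\<close>, scaled to be an integer; it is only used for sets of 2 or 3 elements,
  where the division is exact.\<close>

definition wt :: "'a set \<Rightarrow> int" where
  "wt F = 6 div int (card F)"

text \<open>The contribution of an ordered pair of sets to the sum of squared weighted degrees, compared
  with the value 9 that two distinct intersecting edges contribute.\<close>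

definition excess :: "'a set \<Rightarrow> 'a set \<Rightarrow> int" where
  "excess F G = wt F * wt G * int (card (F \<inter> G)) - 9 * of_bool (F \<inter> G \<noteq> {})"

lemma wt_simps [simp]: "card F = 2 \<Longrightarrow> wt F = 3" "card F = 3 \<Longrightarrow> wt F = 2"
  by (simp_all add: wt_def)

lemma sum_of_bool_mem:
  assumes "finite X" "F \<subseteq> X"
  shows "(\<Sum>x\<in>X. of_bool (x \<in> F)) = int (card F)"
  using assms by (simp add: of_bool_def sum.If_cases Int_absorb1)

lemma sum_weighted_degree:
  fixes w :: "'a set \<Rightarrow> int"
  assumes "finite X" "\<B> \<subseteq> Pow X"
  shows "(\<Sum>x\<in>X. \<Sum>F\<in>\<B>. w F * of_bool (x \<in> F)) = (\<Sum>F\<in>\<B>. w F * int (card F))"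
proof -
  have "(\<Sum>x\<in>X. \<Sum>F\<in>\<B>. w F * of_bool (x \<in> F)) = (\<Sum>F\<in>\<B>. w F * (\<Sum>x\<in>X. of_bool (x \<in> F)))"
    by (subst sum.swap) (simp only: sum_distrib_left)
  also have "\<dots> = (\<Sum>F\<in>\<B>. w F * int (card F))"
    using assms by (intro sum.cong refl) (subst sum_of_bool_mem, auto)
  finally show ?thesis .
qed

lemma sum_weighted_degree_squared:
  fixes w :: "'a set \<Rightarrow> int"
  assumes "finite X" "\<B> \<subseteq> Pow X"
  shows "(\<Sum>x\<in>X. (\<Sum>F\<in>\<B>. w F * of_bool (x \<in> F))\<^sup>2) =
    (\<Sum>F\<in>\<B>. \<Sum>G\<in>\<B>. w F * w G * int (card (F \<inter> G)))"
proof -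
  have "(\<Sum>x\<in>X. (\<Sum>F\<in>\<B>. w F * of_bool (x \<in> F))\<^sup>2) =
      (\<Sum>x\<in>X. \<Sum>F\<in>\<B>. \<Sum>G\<in>\<B>. w F * w G * of_bool (x \<in> F \<inter> G))"
    unfolding power2_eq_square sum_product
    by (intro sum.cong refl) (auto simp: of_bool_def)
  also have "\<dots> = (\<Sum>F\<in>\<B>. \<Sum>x\<in>X. \<Sum>G\<in>\<B>. w F * w G * of_bool (x \<in> F \<inter> G))"
    by (rule sum.swap)
  also have "\<dots> = (\<Sum>F\<in>\<B>. \<Sum>G\<in>\<B>. \<Sum>x\<in>X. w F * w G * of_bool (x \<in> F \<inter> G))"
    by (intro sum.cong refl sum.swap)
  also have "\<dots> = (\<Sum>F\<in>\<B>. \<Sum>G\<in>\<B>. w F * w G * (\<Sum>x\<in>X. of_bool (x \<in> F \<inter> G)))"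
    by (simp only: sum_distrib_left)
  also have "\<dots> = (\<Sum>F\<in>\<B>. \<Sum>G\<in>\<B>. w F * w G * int (card (F \<inter> G)))"
    using assms by (intro sum.cong refl) (subst sum_of_bool_mem, auto)
  finally show ?thesis .
qed

section \<open>The excess charged to a triple\<close>

lemma card_Int_edge:
  assumes "card F = 2" "card G = 2" "F \<noteq> G"
  shows "card (F \<inter> G) \<le> 1"
proof (rule ccontr)
  assume "\<not> card (F \<inter> G) \<le> 1"
  moreover have "finite F" "finite G"
    using assms by (auto intro: card_ge_0_finite)
  ultimately have "F \<inter> G = F" "F \<inter> G = G"
    using assms by (simp_all add: card_seteq)
  with assms(3) show False by blast
qed

lemma excess_edges:
  assumes "card F = 2" "card G = 2"
  shows "excess F G = (if F = G then 9 else 0)"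
proof (cases "F = G")
  case True
  then show ?thesis using assms by (auto simp: excess_def)
next
  case False
  have "finite F" using assms by (auto intro: card_ge_0_finite)
  then have "card (F \<inter> G) = of_bool (F \<inter> G \<noteq> {})"
    using card_Int_edge[OF assms False] by (auto simp: le_Suc_eq)
  then show ?thesis using assms False by (auto simp: excess_def)
qed

lemma excess_commute: "excess F G = excess G F"
  by (simp add: excess_def Int_commute)

text \<open>The excess of the pairs formed by a triple \<open>t\<close> and a set \<open>G\<close>, as charged to \<open>t\<close>: if \<open>G\<close> is an edge,
  both orders of the pair are charged to \<open>t\<close>; if \<open>G\<close> is a triple, the other order is charged to \<open>G\<close>.\<close>

definition charge :: "'a set \<Rightarrow> 'a set \<Rightarrow> int" where
  "charge t G = (if card G = 2 then 2 else 1) * excess t G"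

text \<open>The triple itself is charged 3, and each of its at most three edges 6.\<close>

lemma charge_inside:
  assumes "card t = 3" "\<B> \<subseteq> {G. 2 \<le> card G}"
  shows "(\<Sum>G\<in>{G \<in> \<B>. G \<subseteq> t}. charge t G) \<le> 21"
proof -
  have fin: "finite t" using assms(1) by (auto intro: card_ge_0_finite)
  let ?P = "{G. G \<subseteq> t \<and> card G = 2}"
  have finP: "finite ?P" using fin by simp
  have cP: "card ?P = 3"
    using n_subsets[OF fin, of 2] assms(1) by (simp add: numeral_eq_Suc)
  have t: "t \<notin> ?P" using assms by simp
  have sub: "{G \<in> \<B>. G \<subseteq> t} \<subseteq> insert t ?P"
  proof
    fix G assume G: "G \<in> {G \<in> \<B>. G \<subseteq> t}"
    then have "card G \<le> 3" "2 \<le> card G" using card_mono[OF fin, of G] assms by auto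
    moreover have "G = t" if "card G = 3"
      using G that assms(1) fin by (intro card_seteq) auto
    ultimately show "G \<in> insert t ?P" using G by (cases "card G = 2") auto
  qed
  have val: "charge t G = 6" if "G \<in> ?P" for G
  proof -
    have "t \<inter> G = G" "G \<noteq> {}" using that by auto
    then show ?thesis using that assms by (simp add: charge_def excess_def)
  qed
  have valt: "charge t t = 3"
    using assms by (auto simp: charge_def excess_def)
  have "(\<Sum>G\<in>{G \<in> \<B>. G \<subseteq> t}. charge t G) \<le> (\<Sum>G\<in>insert t ?P. charge t G)"
    using sub finP val valt by (intro sum_mono2) auto
  also have "\<dots> = 3 + (\<Sum>G\<in>?P. 6)"
    using t finP val valt by simp
  finally show ?thesis using cP by simp
qed

text \<open>At most 7 of the members meeting \<open>t\<close> lie inside it, so at least three do not. An edge or triple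
  meeting \<open>t\<close> in one point is charged \<open>-6\<close> or \<open>-5\<close>. A triple sharing two points with \<open>t\<close> is charged
  only \<open>-1\<close>, but downward closure then supplies two edges meeting \<open>t\<close> in one point.\<close>

lemma charge_sum:
  assumes fin: "finite \<A>"
    and down: "\<And>F G. F \<in> \<A> \<Longrightarrow> G \<subseteq> F \<Longrightarrow> G \<noteq> {} \<Longrightarrow> G \<in> \<A>"
    and le3: "\<And>F. F \<in> \<A> \<Longrightarrow> card F \<le> 3"
    and t: "t \<in> \<A>" "card t = 3"
    and deg: "10 \<le> card (touching \<A> t)"
  shows "(\<Sum>G\<in>{G \<in> \<A>. 2 \<le> card G}. charge t G) \<le> 12"
proof -
  let ?B = "{G \<in> \<A>. 2 \<le> card G}"
  have fint: "finite t" using t by (auto intro: card_ge_0_finite)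
  define M where "M = {G \<in> ?B. G \<inter> t \<noteq> {} \<and> \<not> G \<subseteq> t}"
  have finM: "finite M" using fin by (simp add: M_def)
  have "card (touching \<A> t) \<le> card ((Pow t - {{}}) \<union> M)"
  proof (rule card_mono)
    show "touching \<A> t \<subseteq> Pow t - {{}} \<union> M"
    proof
      fix G assume G: "G \<in> touching \<A> t"
      show "G \<in> Pow t - {{}} \<union> M"
      proof (cases "G \<subseteq> t")
        case False
        have "2 \<le> card G" if "finite G"
        proof -
          obtain x y where "x \<in> G" "x \<in> t" "y \<in> G" "y \<notin> t"
            using G False by (auto simp: touching_def)
          moreover then have "x \<noteq> y" by auto
          ultimately have "{x, y} \<subseteq> G" "card {x, y} = 2" by auto
          then show ?thesis using card_mono[OF that] by metis
        qed
        \<comment> \<open>The bound on cardinalities does not rule out infinite members directly, as these have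
          cardinality 0; their 4-element subsets do.\<close>
        moreover have "finite G"
        proof (rule ccontr)
          assume inf: "infinite G"
          then obtain H where "H \<subseteq> G" "card H = 4" "finite H"
            using infinite_arbitrarily_large by blast
          moreover then have "H \<noteq> {}" by auto
          ultimately show False using down[of G H] le3[of H] G by (simp add: touching_def)
        qed
        ultimately show ?thesis using G False by (auto simp: M_def touching_def)
      qed (use G in \<open>auto simp: touching_def\<close>)
    qed
    show "finite (Pow t - {{}} \<union> M)" using fint finM by simp
  qed
  also have "\<dots> \<le> card (Pow t - {{}}) + card M" by (rule card_Un_le)
  also have "card (Pow t - {{}}) = 7" using fint t by (simp add: card_Pow)
  finally have M3: "3 \<le> card M" using deg by simp
  have small: "charge t G \<le> -5 \<or> (card G = 3 \<and> card (t \<inter> G) = 2 \<and> charge t G = -1)"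
    if G: "G \<in> M" for G
  proof -
    have finG: "finite G" using G by (auto simp: M_def intro: card_ge_0_finite)
    have pos: "card (t \<inter> G) > 0" using G finG by (auto simp: M_def card_gt_0_iff)
    have "t \<inter> G \<subset> G" using G by (auto simp: M_def)
    then have lt: "card (t \<inter> G) < card G" using finG psubset_card_mono by blast
    have "card G = 2 \<or> card G = 3" using G le3[of G] by (auto simp: M_def)
    then show ?thesis
    proof
      assume c: "card G = 2"
      then have "card (t \<inter> G) = 1" using pos lt by simp
      moreover then have "t \<inter> G \<noteq> {}" by auto
      ultimately show ?thesis using c t by (simp add: charge_def excess_def)
    next
      assume c: "card G = 3"
      then have "card (t \<inter> G) = 1 \<or> card (t \<inter> G) = 2" using pos lt by auto
      moreover have "t \<inter> G \<noteq> {}" using pos by auto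
      ultimately show ?thesis using c t by (auto simp: charge_def excess_def)
    qed
  qed
  have sumM: "(\<Sum>G\<in>M. charge t G) \<le> -9"
  proof (cases "\<forall>G\<in>M. charge t G \<le> -5")
    case True
    then have "(\<Sum>G\<in>M. charge t G) \<le> (\<Sum>G\<in>M. -5)" by (intro sum_mono) auto
    then show ?thesis using M3 by simp
  next
    case False
    then obtain G where G: "G \<in> M" "card G = 3" "card (t \<inter> G) = 2" using small by blast
    obtain x y where xy: "t \<inter> G = {x, y}" "x \<noteq> y" using G(3) by (meson card_2_iff)
    obtain w where w: "w \<in> G" "w \<notin> t" using G(1) by (auto simp: M_def)
    let ?P = "{{x, w}, {y, w}}"
    have PM: "?P \<subseteq> M"
    proof -
      have "x \<in> t" "y \<in> t" "x \<in> G" "y \<in> G" using xy by auto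
      moreover then have "x \<noteq> w" "y \<noteq> w" using w by auto
      moreover have "G \<in> \<A>" using G(1) by (simp add: M_def)
      ultimately have "{x, w} \<in> \<A>" "{y, w} \<in> \<A>" "x \<noteq> w" "y \<noteq> w"
        using w by (simp_all add: down[of G])
      then show ?thesis using \<open>x \<in> t\<close> \<open>y \<in> t\<close> w by (auto simp: M_def)
    qed
    have "{x, w} \<noteq> {y, w}" using xy(2) by (auto simp: doubleton_eq_iff)
    then have cP: "card ?P = 2" by (rule card_2_iff [THEN iffD2, OF exI, OF exI, OF conjI [OF refl]])
    have "(\<Sum>G\<in>M. charge t G) = (\<Sum>G\<in>M - ?P. charge t G) + (\<Sum>G\<in>?P. charge t G)"
      using PM finM by (intro sum.subset_diff)
    moreover have "(\<Sum>G\<in>M - ?P. charge t G) \<le> 0"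
    proof (rule sum_nonpos)
      fix G assume "G \<in> M - ?P"
      then show "charge t G \<le> 0" using small[of G] by auto
    qed
    moreover have "(\<Sum>G\<in>?P. charge t G) \<le> (\<Sum>G\<in>?P. -5)"
    proof (rule sum_mono)
      fix G assume "G \<in> ?P"
      moreover then have "card G \<le> 2" by (auto simp: card_insert_if)
      ultimately show "charge t G \<le> -5" using small[of G] PM by auto
    qed
    ultimately show ?thesis using cP by simp
  qed
  have "(\<Sum>G\<in>?B. charge t G) = (\<Sum>G\<in>{G \<in> ?B. G \<subseteq> t} \<union> M. charge t G)"
  proof (rule sum.mono_neutral_right)
    show "\<forall>G\<in>?B - ({G \<in> ?B. G \<subseteq> t} \<union> M). charge t G = 0"
    proof
      fix G assume "G \<in> ?B - ({G \<in> ?B. G \<subseteq> t} \<union> M)"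
      then have "t \<inter> G = {}" by (auto simp: M_def)
      then show "charge t G = 0" by (simp add: charge_def excess_def)
    qed
  qed (use fin in \<open>auto simp: M_def\<close>)
  also have "\<dots> = (\<Sum>G\<in>{G \<in> ?B. G \<subseteq> t}. charge t G) + (\<Sum>G\<in>M. charge t G)"
    using fin finM by (intro sum.union_disjoint) (auto simp: M_def)
  also have "\<dots> \<le> 21 + (-9)"
    by (intro add_mono charge_inside sumM t) auto
  finally show ?thesis by simp
qed

lemma touching_nonsingletons:
  assumes fin: "finite \<A>" and F: "F \<in> \<A>" "finite F" and sing: "\<And>x. x \<in> F \<Longrightarrow> {x} \<in> \<A>"
    and le: "card (touching \<A> F) \<le> k + 1"
  shows "card (touching {G \<in> \<A>. 2 \<le> card G} F) + card F \<le> k + 1"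
proof -
  have "card (touching {G \<in> \<A>. 2 \<le> card G} F) + card F =
     card (touching {G \<in> \<A>. 2 \<le> card G} F) + card ((\<lambda>x. {x}) ` F)"
    by (simp add: card_image)
  also have "\<dots> = card (touching {G \<in> \<A>. 2 \<le> card G} F \<union> (\<lambda>x. {x}) ` F)"
    using fin F by (intro card_Un_disjoint [symmetric]) (auto simp: touching_def)
  also have "\<dots> \<le> card (touching \<A> F)"
    using fin sing by (intro card_mono) (auto simp: touching_def)
  finally show ?thesis using le by simp
qed

section \<open>The upper bound\<close>

text \<open>Up to the factor 9, this is \<open>(d - k / 2)\<^sup>2 \<ge> 0\<close>, respectively
  \<open>(d - (k - 1) / 2) (d - (k + 1) / 2) \<ge> 0\<close> for odd \<open>k\<close>, at \<open>d = p + 2 q / 3\<close>. For odd \<open>k\<close> a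
  non-integral \<open>d\<close> strictly between the two roots costs 2 after scaling, and this forces \<open>q > 0\<close>.\<close>

lemma quadratic_bound:
  fixes p q :: int and k :: nat
  assumes "q \<ge> 0"
  shows "(3 * p + 2 * q)\<^sup>2 - 3 * int k * (3 * p + 2 * q) + 9 * int (k * k div 4) \<ge> - 2 * q"
proof (cases "even k")
  case True
  then obtain r where r: "k = 2 * r" by blast
  then have "k * k div 4 = r * r" by simp
  then have "(3 * p + 2 * q)\<^sup>2 - 3 * int k * (3 * p + 2 * q) + 9 * int (k * k div 4) =
     (3 * p + 2 * q - 3 * int r)\<^sup>2"
    using r by (simp add: power2_eq_square algebra_simps)
  then show ?thesis using assms by (smt (verit) zero_le_power2)
next
  case False
  then obtain r where r: "k = 2 * r + 1" by (auto elim: oddE)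
  then have "k * k = 4 * (r * r + r) + 1" by (simp add: algebra_simps)
  then have c: "k * k div 4 = r * r + r" by simp
  define u where "u = 3 * p + 2 * q - 3 * int r"
  have eq: "(3 * p + 2 * q)\<^sup>2 - 3 * int k * (3 * p + 2 * q) + 9 * int (k * k div 4) = u * (u - 3)"
    unfolding c u_def using r by (simp add: power2_eq_square algebra_simps)
  show ?thesis
  proof (cases "1 \<le> u \<and> u \<le> 2")
    case True
    then have "u = 1 \<or> u = 2" by auto
    then have "u * (u - 3) = -2" by auto
    moreover have "q \<noteq> 0"
    proof
      assume "q = 0"
      then have "u = 3 * (p - int r)" by (simp add: u_def)
      then show False using True by presburger
    qed
    ultimately show ?thesis using eq assms by linarith
  next
    case False
    then have "u \<le> 0 \<or> u \<ge> 3" by auto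
    then have "u * (u - 3) \<ge> 0" by (auto simp: zero_le_mult_iff)
    then show ?thesis using eq assms by linarith
  qed
qed

text \<open>Here \<open>\<A>\<close> is closed under nonempty subsets and no vertex set can profitably be deleted.\<close>

lemma irreducible_bound:
  assumes finX: "finite X" and sub: "\<A> \<subseteq> Pow X" and ne: "{} \<notin> \<A>"
    and le: "\<And>F. F \<in> \<A> \<Longrightarrow> card (touching \<A> F) \<le> k + 1"
    and down: "\<And>F G. F \<in> \<A> \<Longrightarrow> G \<subseteq> F \<Longrightarrow> G \<noteq> {} \<Longrightarrow> G \<in> \<A>"
    and irr: "\<And>S. S \<subseteq> X \<Longrightarrow> S \<noteq> {} \<Longrightarrow> (k * k div 4 + k) * card S < k * card (touching \<A> S)"
  shows "k * card \<A> \<le> (k * k div 4 + k) * card X"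
proof (cases "X = {}")
  case True
  then have "\<A> = {}" using sub ne by auto
  then show ?thesis by simp
next
  case X: False
  define c where "c = k * k div 4"
  have c4: "k * k \<le> 4 * c + 1"
  proof (cases "even k")
    case True
    then show ?thesis unfolding c_def by (auto elim!: evenE)
  next
    case False
    then obtain r where r: "k = 2 * r + 1" by (auto elim: oddE)
    then have "k * k = 4 * (r * r + r) + 1" by (simp add: algebra_simps)
    then have "c = r * r + r" "k * k = 4 * (r * r + r) + 1" unfolding c_def by simp_all
    then show ?thesis by simp
  qed
  have kpos: "k > 0" using irr[of X] X by (cases k) auto
  have finA: "finite \<A>" using finX sub by (meson finite_Pow_iff finite_subset)
  have finF: "finite F" if "F \<in> \<A>" for F using that sub finX finite_subset by blast
  have sing: "{x} \<in> \<A>" if "x \<in> X" for x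
  proof -
    have "card (touching \<A> {x}) > 0" using irr[of "{x}"] that by (cases "card (touching \<A> {x})") auto
    then obtain F where "F \<in> touching \<A> {x}" by fastforce
    then show ?thesis using down[of F "{x}"] by (auto simp: touching_def)
  qed
  have Tdeg: "(c + k) * card F < k * card (touching \<A> F)" if "F \<in> \<A>" for F
    using irr[of F] that sub ne by (auto simp: c_def)
  have le3: "card F \<le> 3" if F: "F \<in> \<A>" for F
  proof (rule ccontr)
    assume "\<not> card F \<le> 3"
    then have "(c + k) * 4 \<le> (c + k) * card F" by (intro mult_le_mono2) simp
    also have "\<dots> < k * card (touching \<A> F)" by (rule Tdeg[OF F])
    also have "\<dots> \<le> k * (k + 1)" using le[OF F] by (rule mult_le_mono2)
    finally show False using c4 kpos by simp
  qed
  \<comment> \<open>If a triple cannot be deleted, then \<open>3 (c + k) < k (k + 1)\<close>, which forces \<open>k \<ge> 8\<close>;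
    then \<open>3 (c + k) \<ge> 9 k\<close>, so more than 9 members meet it.\<close>
  have deg10: "10 \<le> card (touching \<A> t)" if t: "t \<in> \<A>" "card t = 3" for t
  proof -
    let ?D = "card (touching \<A> t)"
    have a: "(c + k) * 3 < k * ?D" using Tdeg[OF t(1)] t by simp
    also have b: "k * ?D \<le> k * (k + 1)" using le[OF t(1)] by (rule mult_le_mono2)
    finally have kk: "k * 8 < k * k + 3" using c4 by simp
    have k8: "8 \<le> k"
    proof (rule ccontr)
      assume "\<not> 8 \<le> k"
      then have "k = 1 \<or> k = 2 \<or> k = 3 \<or> k = 4 \<or> k = 5 \<or> k = 6 \<or> k = 7" using kpos by arith
      then show False using kk by auto
    qed
    show ?thesis
    proof (rule ccontr)
      assume "\<not> 10 \<le> ?D"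
      then have "k * ?D \<le> k * 9" by (intro mult_le_mono2) simp
      with a have "(c + k) * 3 < k * 9" by (rule less_le_trans)
      moreover have "8 * k \<le> k * k" using k8 by (intro mult_le_mono1)
      then have "8 * k \<le> 4 * c + 1" using c4 by (rule le_trans)
      ultimately show False by presburger
    qed
  qed
  define B where "B = {G \<in> \<A>. 2 \<le> card G}"
  define E where "E = {G \<in> \<A>. card G = 2}"
  define T where "T = {G \<in> \<A>. card G = 3}"
  have BET: "B = E \<union> T" "E \<inter> T = {}" using le3 by (fastforce simp: B_def E_def T_def)+
  have fin: "finite B" "finite E" "finite T" using finA by (auto simp: B_def E_def T_def)
  have BX: "B \<subseteq> Pow X" "T \<subseteq> Pow X" using sub by (auto simp: B_def T_def)
  have Ecard: "card F = 2" if "F \<in> E" for F using that by (simp add: E_def)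
  have Tcard: "card F = 3" if "F \<in> T" for F using that by (simp add: T_def)
  have sumB: "(\<Sum>F\<in>B. g F) = (\<Sum>F\<in>E. g F) + (\<Sum>F\<in>T. g F)" for g :: "'a set \<Rightarrow> int"
    unfolding BET(1) using fin BET(2) by (intro sum.union_disjoint) auto
  have cardB: "card B = card E + card T"
    unfolding BET(1) using fin BET(2) by (intro card_Un_disjoint) auto
  have cardA: "card \<A> = card X + card B"
  proof -
    have "\<A> = (\<lambda>x. {x}) ` X \<union> B"
    proof
      show "\<A> \<subseteq> (\<lambda>x. {x}) ` X \<union> B"
      proof
        fix F assume F: "F \<in> \<A>"
        show "F \<in> (\<lambda>x. {x}) ` X \<union> B"
        proof (cases "2 \<le> card F")
          case False
          have "card F > 0" using F ne finF by (auto simp: card_gt_0_iff)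
          then have "card F = 1" using False by simp
          then obtain x where "F = {x}" by (auto simp: card_1_singleton_iff)
          then show ?thesis using F sub by auto
        qed (use F in \<open>simp add: B_def\<close>)
      qed
    qed (use sing in \<open>auto simp: B_def\<close>)
    moreover have "card ((\<lambda>x. {x}) ` X \<union> B) = card ((\<lambda>x. {x}) ` X) + card B"
      using finX fin by (intro card_Un_disjoint) (auto simp: B_def)
    ultimately show ?thesis by (simp add: card_image)
  qed
  \<comment> \<open>The weighted degree of \<open>x\<close>, and the number of triples containing \<open>x\<close>.\<close>
  define b where "b x = (\<Sum>F\<in>B. wt F * of_bool (x \<in> F))" for x
  define q where "q x = (\<Sum>F\<in>T. (1::int) * of_bool (x \<in> F))" for x
  have q0: "q x \<ge> 0" for x unfolding q_def by (intro sum_nonneg) auto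
  have bpq: "b x = 3 * (\<Sum>F\<in>E. of_bool (x \<in> F)) + 2 * q x" for x
    unfolding b_def sumB q_def sum_distrib_left
    by (intro arg_cong2[where f = "(+)"] sum.cong refl) (simp_all add: Ecard Tcard)
  have sumq: "(\<Sum>x\<in>X. q x) = 3 * int (card T)"
    unfolding q_def sum_weighted_degree[OF finX BX(2)] by (simp add: Tcard)
  have sumb: "(\<Sum>x\<in>X. b x) = 6 * int (card B)"
    unfolding b_def sum_weighted_degree[OF finX BX(1)] by (simp add: sumB Ecard Tcard cardB)
  have "(\<Sum>x\<in>X. - 2 * q x) \<le> (\<Sum>x\<in>X. (b x)\<^sup>2 - 3 * int k * b x + 9 * int c)"
    unfolding bpq c_def by (intro sum_mono quadratic_bound q0)
  then have lower: "18 * int k * int (card B) - 9 * int c * int (card X) - 6 * int (card T) \<le> (\<Sum>x\<in>X. (b x)\<^sup>2)"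
    by (simp add: sum.distrib sum_subtractf sum_negf sumq sumb flip: sum_distrib_left)
      (simp add: algebra_simps)
  have "(\<Sum>x\<in>X. (b x)\<^sup>2) = (\<Sum>F\<in>B. \<Sum>G\<in>B. wt F * wt G * int (card (F \<inter> G)))"
    unfolding b_def by (rule sum_weighted_degree_squared[OF finX BX(1)])
  also have "\<dots> = (\<Sum>F\<in>B. \<Sum>G\<in>B. excess F G) + 9 * (\<Sum>F\<in>B. int (card (touching B F)))"
  proof -
    have "int (card (touching B F)) = (\<Sum>G\<in>B. of_bool (F \<inter> G \<noteq> {}))" for F
      using fin by (simp add: touching_def Int_commute of_bool_def sum.If_cases Int_def)
    then show ?thesis
      by (simp only: excess_def sum_subtractf sum_distrib_left)
  qed
  also have "(\<Sum>F\<in>B. int (card (touching B F))) \<le> (int k - 1) * card E + (int k - 2) * card T"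
  proof -
    have "int (card (touching B F)) \<le> int k + 1 - card F" if "F \<in> B" for F
    proof -
      have F: "F \<in> \<A>" using that by (simp add: B_def)
      have "card (touching B F) + card F \<le> k + 1"
        unfolding B_def using finA F finF sing sub le by (intro touching_nonsingletons) auto
      then show ?thesis by simp
    qed
    then have "(\<Sum>F\<in>B. int (card (touching B F))) \<le> (\<Sum>F\<in>B. int k + 1 - card F)"
      by (rule sum_mono)
    also have "\<dots> = (int k - 1) * card E + (int k - 2) * card T"
      by (simp add: sumB Ecard Tcard)
    finally show ?thesis .
  qed
  also have "(\<Sum>F\<in>B. \<Sum>G\<in>B. excess F G) \<le> 9 * int (card E) + 12 * int (card T)"
  proof -
    have "(\<Sum>F\<in>B. \<Sum>G\<in>B. excess F G) = (\<Sum>F\<in>E. \<Sum>G\<in>E. excess F G) + (\<Sum>F\<in>E. \<Sum>G\<in>T. excess F G)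
       + ((\<Sum>F\<in>T. \<Sum>G\<in>E. excess F G) + (\<Sum>F\<in>T. \<Sum>G\<in>T. excess F G))"
      by (simp add: sumB sum.distrib)
    also have "(\<Sum>F\<in>E. \<Sum>G\<in>T. excess F G) = (\<Sum>F\<in>T. \<Sum>G\<in>E. excess F G)"
      by (subst sum.swap) (simp add: excess_commute)
    also have "(\<Sum>F\<in>E. \<Sum>G\<in>E. excess F G) = (\<Sum>F\<in>E. \<Sum>G\<in>E. if F = G then 9 else 0)"
      by (intro sum.cong refl excess_edges Ecard)
    also have "\<dots> = 9 * int (card E)" using fin by simp
    finally have "(\<Sum>F\<in>B. \<Sum>G\<in>B. excess F G) = 9 * int (card E) + (\<Sum>F\<in>T. \<Sum>G\<in>B. charge F G)"
      by (simp add: sumB charge_def Ecard Tcard sum.distrib flip: sum_distrib_left)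
    moreover have "(\<Sum>F\<in>T. \<Sum>G\<in>B. charge F G) \<le> (\<Sum>F\<in>T. 12)"
      unfolding B_def using deg10 finA down le3 by (intro sum_mono charge_sum) (auto simp: T_def)
    ultimately show ?thesis by simp
  qed
  finally have upper: "(\<Sum>x\<in>X. (b x)\<^sup>2) \<le> 9 * int k * card B - 6 * card T"
    by (simp add: cardB algebra_simps)
  have "int (k * card B) \<le> int (c * card X)"
    using lower upper by simp
  then have "k * card B \<le> c * card X" by (simp only: of_nat_le_iff)
  then show ?thesis unfolding cardA c_def by (simp add: algebra_simps)
qed

text \<open>The induction measure decreases both when vertices are deleted and when a member is replaced by
  a proper subset.\<close>

lemma nonempty_family_bound:
  assumes "finite X" and "\<A> \<subseteq> Pow X" and "{} \<notin> \<A>"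
    and "\<And>F. F \<in> \<A> \<Longrightarrow> card (touching \<A> F) \<le> k + 1"
  shows "k * card \<A> \<le> (k * k div 4 + k) * card X"
  using assms
proof (induction "card X + (\<Sum>F\<in>\<A>. card F)" arbitrary: X \<A> rule: less_induct)
  case less
  note finX = less.prems(1) and sub = less.prems(2) and ne = less.prems(3) and le = less.prems(4)
  let ?c = "k * k div 4 + k"
  have finA: "finite \<A>" using finX sub by (meson finite_Pow_iff finite_subset)
  have finF: "finite F" if "F \<in> \<A>" for F using that sub finX finite_subset by blast
  consider (delete) S where "S \<subseteq> X" "S \<noteq> {}" "k * card (touching \<A> S) \<le> ?c * card S"
    | (shrink) F G where "F \<in> \<A>" "G \<subseteq> F" "G \<noteq> {}" "G \<notin> \<A>"
    | (irr) "\<And>F G. F \<in> \<A> \<Longrightarrow> G \<subseteq> F \<Longrightarrow> G \<noteq> {} \<Longrightarrow> G \<in> \<A>"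
       "\<And>S. S \<subseteq> X \<Longrightarrow> S \<noteq> {} \<Longrightarrow> ?c * card S < k * card (touching \<A> S)"
    by (meson not_le)
  then show ?case
  proof cases
    case delete
    let ?A = "\<A> - touching \<A> S"
    have finS: "finite S" using delete(1) finX finite_subset by blast
    have "card (X - S) < card X" using delete finX by (intro psubset_card_mono) auto
    moreover have "(\<Sum>F\<in>?A. card F) \<le> (\<Sum>F\<in>\<A>. card F)" using finA by (intro sum_mono2) auto
    ultimately have "card (X - S) + (\<Sum>F\<in>?A. card F) < card X + (\<Sum>F\<in>\<A>. card F)" by simp
    then have "k * card ?A \<le> ?c * card (X - S)"
    proof (rule less.hyps)
      show "?A \<subseteq> Pow (X - S)" using sub by (auto simp: touching_def)
      fix F assume "F \<in> ?A"
      moreover have "card (touching ?A F) \<le> card (touching \<A> F)"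
        using finA by (intro card_mono) (auto simp: touching_def)
      ultimately show "card (touching ?A F) \<le> k + 1" using le[of F] by simp
    qed (use finX ne in auto)
    moreover have "card \<A> = card (touching \<A> S) + card ?A"
      using finA by (subst card_Un_disjoint [symmetric]) (auto simp: touching_def intro: arg_cong[where f = card])
    moreover have "card X = card S + card (X - S)"
      using card_Diff_subset[OF finS delete(1)] card_mono[OF finX delete(1)] by simp
    ultimately show ?thesis using delete(3) by (simp add: distrib_left)
  next
    case shrink
    let ?A = "insert G (\<A> - {F})"
    have cA: "card ?A = card \<A>"
      using shrink finA by (simp add: card.insert_remove card_Diff_singleton)
        (metis Suc_pred card_gt_0_iff empty_iff)
    have "G \<subset> F" using shrink by auto
    then have "card G < card F" using finF shrink psubset_card_mono by blast
    moreover have "(\<Sum>F\<in>?A. card F) = card G + (\<Sum>F\<in>\<A> - {F}. card F)"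
      using shrink finA by simp
    moreover have "(\<Sum>F\<in>\<A>. card F) = card F + (\<Sum>F\<in>\<A> - {F}. card F)"
      using shrink finA by (intro sum.remove) auto
    ultimately have "card X + (\<Sum>F\<in>?A. card F) < card X + (\<Sum>F\<in>\<A>. card F)" by simp
    then have "k * card ?A \<le> ?c * card X"
    proof (rule less.hyps)
      \<comment> \<open>A set that meets the new member \<open>G\<close> also met the replaced member \<open>F\<close>.\<close>
      have tG: "card (touching ?A H) \<le> card (touching \<A> H)" for H
      proof (cases "G \<inter> H = {}")
        case True
        then have "touching ?A H \<subseteq> touching \<A> H" by (auto simp: touching_def)
        then show ?thesis using finA by (intro card_mono) (auto simp: touching_def)
      next
        case False
        then have F: "F \<in> touching \<A> H" using shrink by (auto simp: touching_def)
        have "touching ?A H = insert G (touching \<A> H - {F})"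
          using False by (auto simp: touching_def)
        moreover have "card (insert G (touching \<A> H - {F})) \<le> Suc (card (touching \<A> H - {F}))"
          by (rule card_insert_le_m1) auto
        moreover have "Suc (card (touching \<A> H - {F})) = card (touching \<A> H)"
          using F finA by (intro card.remove [symmetric]) (auto simp: touching_def)
        ultimately show ?thesis by simp
      qed
      fix H assume H: "H \<in> ?A"
      show "card (touching ?A H) \<le> k + 1"
      proof (cases "H = G")
        case True
        have "card (touching \<A> G) \<le> card (touching \<A> F)"
          using shrink finA by (intro card_mono) (auto simp: touching_def)
        then show ?thesis using le[OF shrink(1)] tG[of G] True by simp
      next
        case False
        then show ?thesis using le[of H] tG[of H] H by simp
      qed
    qed (use finX sub ne shrink in auto)
    then show ?thesis by (simp only: cA)
  next
    case irr
    show ?thesis using finX sub ne le irr by (rule irreducible_bound)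
  qed
qed



section \<open>Families from graphs\<close>

text \<open>The edge \<open>xy\<close> meets the singletons of its two ends and, apart from itself, at most
  \<open>d(x) + d(y) - 2\<close> edges.\<close>

lemma almost_Fisher_graph:
  fixes E :: "nat set set"
  assumes EX: "E \<subseteq> Pow {1..n}" and two: "\<And>e. e \<in> E \<Longrightarrow> card e = 2"
    and deg: "\<And>x y. {x, y} \<in> E \<Longrightarrow> card {e \<in> E. x \<in> e} + card {e \<in> E. y \<in> e} \<le> k"
  shows "almost_Fisher n k 0 (insert {} ((\<lambda>x. {x}) ` {1..n} \<union> E))"
    and "card (insert {} ((\<lambda>x. {x}) ` {1..n} \<union> E)) = n + card E + 1"
proof -
  let ?S = "(\<lambda>x. {x}) ` {1..n}"
  let ?F = "insert {} (?S \<union> E)"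
  have finE: "finite E" using EX by (meson finite_Pow_iff finite_atLeastAtMost finite_subset)
  show "card ?F = n + card E + 1"
  proof -
    have "{} \<notin> ?S \<union> E" using two by force
    moreover have "card (?S \<union> E) = card ?S + card E"
      using two finE by (intro card_Un_disjoint) force+
    ultimately show ?thesis using finE by (simp add: card_image)
  qed
  have meets: "card (F \<inter> G) \<noteq> 0 \<longleftrightarrow> F \<inter> G \<noteq> {}" if "F \<in> ?F" for F G :: "nat set"
  proof -
    have "finite F" using that EX by (auto intro: finite_subset)
    then show ?thesis by (simp add: card_eq_0_iff)
  qed
  have "card {G \<in> ?F - {F}. F \<inter> G \<noteq> {}} \<le> k" if mem: "F \<in> ?F" for F
  proof -
    consider "F = {}" | x where "F = {x}" | (edge) "F \<in> E" using mem by blast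
    then show ?thesis
    proof cases
      case 1
      then show ?thesis by simp
    next
      case (2 x)
      have "card {G \<in> ?F - {F}. F \<inter> G \<noteq> {}} \<le> card {e \<in> E. x \<in> e}"
        using finE 2 by (intro card_mono) auto
      also have "\<dots> \<le> k"
      proof (cases "{e \<in> E. x \<in> e} = {}")
        case False
        then obtain e where e: "e \<in> E" "x \<in> e" by blast
        then obtain y where "e = {x, y}"
          using two[OF e(1)] by (auto simp: card_2_iff)
        then show ?thesis using deg[of x y] e by simp
      qed (simp only: card.empty)
      finally show ?thesis .
    next
      case edge
      then obtain x y where F: "F = {x, y}" "x \<noteq> y" using two[OF edge] by (auto simp: card_2_iff)
      let ?x = "{e \<in> E. x \<in> e}" and ?y = "{e \<in> E. y \<in> e}"
      have "card {G \<in> ?F - {F}. F \<inter> G \<noteq> {}} \<le> card ({{x}, {y}} \<union> ((?x - {F}) \<union> (?y - {F})))"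
        using finE F by (intro card_mono) auto
      also have "\<dots> \<le> card {{x}, {y}} + (card (?x - {F}) + card (?y - {F}))"
        by (intro order_trans[OF card_Un_le] add_left_mono card_Un_le)
      also have "card {{x}, {y}} = 2" using F by simp
      also have "card (?x - {F}) = card ?x - 1" using edge F finE by (simp add: card_Diff_singleton)
      also have "card (?y - {F}) = card ?y - 1" using edge F finE by (simp add: card_Diff_singleton)
      finally have "card {G \<in> ?F - {F}. F \<inter> G \<noteq> {}} \<le> 2 + (card ?x - 1 + (card ?y - 1))" .
      moreover have "card ?x > 0" "card ?y > 0" using edge F finE by (auto simp: card_gt_0_iff)
      moreover have "card ?x + card ?y \<le> k" using deg[of x y] edge F by simp
      ultimately show ?thesis by linarith
    qed
  qed
  moreover have "{G \<in> ?F - {F}. card (F \<inter> G) \<noteq> 0} = {G \<in> ?F - {F}. F \<inter> G \<noteq> {}}"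
    if "F \<in> ?F" for F using meets[OF that] by blast
  moreover have "?F \<subseteq> Pow {1..n}" using EX by auto
  ultimately show "almost_Fisher n k 0 ?F"
    unfolding almost_Fisher_def by (metis (no_types, lifting))
qed

text \<open>The edge set of the graph on \<open>{1..n}\<close> given by a symmetric irreflexive relation.\<close>

definition edges :: "nat \<Rightarrow> (nat \<Rightarrow> nat \<Rightarrow> bool) \<Rightarrow> nat set set" where
  "edges n R = {{x, y} | x y. x \<in> {1..n} \<and> y \<in> {1..n} \<and> R x y}"

lemma edges_degree:
  assumes sym: "\<And>x y. R x y \<Longrightarrow> R y x" and x: "x \<in> {1..n}"
  shows "card {e \<in> edges n R. x \<in> e} = card {y \<in> {1..n}. R x y}"
proof -
  have "{e \<in> edges n R. x \<in> e} = (\<lambda>y. {x, y}) ` {y \<in> {1..n}. R x y}"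
    using sym x by (auto simp: edges_def)
  moreover have "inj_on (\<lambda>y. {x, y}) A" for A
    by (auto simp: inj_on_def doubleton_eq_iff)
  ultimately show ?thesis by (simp add: card_image)
qed

lemma edges_subset: "edges n R \<subseteq> Pow {1..n}"
  by (auto simp: edges_def)

lemma card_edge:
  assumes "\<And>x. \<not> R x x" "e \<in> edges n R"
  shows "card e = 2"
proof -
  obtain x y where "e = {x, y}" "R x y" using assms(2) by (auto simp: edges_def)
  then show ?thesis using assms(1) by (cases "x = y") auto
qed

lemma handshake:
  assumes sym: "\<And>x y. R x y \<Longrightarrow> R y x" and irr: "\<And>x. \<not> R x x"
  shows "(\<Sum>x\<in>{1..n}. card {y \<in> {1..n}. R x y}) = 2 * card (edges n R)"
proof -
  have fin: "finite (edges n R)"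
    by (rule finite_subset[OF edges_subset]) simp
  have "(\<Sum>x\<in>{1..n}. card {y \<in> {1..n}. R x y}) = (\<Sum>x\<in>{1..n}. card {e \<in> edges n R. x \<in> e})"
    using edges_degree[of R, OF sym] by (intro sum.cong) auto
  also have "\<dots> = (\<Sum>e\<in>edges n R. card {x \<in> {1..n}. x \<in> e})"
    using fin by (intro sum_multicount_gen) auto
  also have "\<dots> = (\<Sum>e\<in>edges n R. 2)"
  proof (intro sum.cong refl)
    fix e assume e: "e \<in> edges n R"
    then have "{x \<in> {1..n}. x \<in> e} = e" using edges_subset[of n R] by blast
    then show "card {x \<in> {1..n}. x \<in> e} = 2" using card_edge[of R, OF irr e] by simp
  qed
  finally show ?thesis by simp
qed

lemma graph_attains:
  assumes sym: "\<And>x y. R x y \<Longrightarrow> R y x" and irr: "\<And>x. \<not> R x x"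
    and deg: "\<And>x y. x \<in> {1..n} \<Longrightarrow> y \<in> {1..n} \<Longrightarrow> R x y \<Longrightarrow>
      card {z \<in> {1..n}. R x z} + card {z \<in> {1..n}. R y z} \<le> k"
    and total: "k * (\<Sum>x\<in>{1..n}. card {y \<in> {1..n}. R x y}) = 2 * ((k * k div 4) * n)"
  shows "\<exists>\<F>. almost_Fisher n k 0 \<F> \<and> k * card \<F> = (k * k div 4 + k) * n + k"
proof -
  let ?E = "edges n R"
  have "card {e \<in> ?E. x \<in> e} + card {e \<in> ?E. y \<in> e} \<le> k" if e: "{x, y} \<in> ?E" for x y
  proof -
    have "x \<in> {1..n}" "y \<in> {1..n}" "R x y"
      using e sym by (auto simp: edges_def doubleton_eq_iff)
    then show ?thesis using deg edges_degree[of R, OF sym] by simp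
  qed
  note G = almost_Fisher_graph[OF edges_subset card_edge[of R, OF irr] this]
  have "k * card ?E = (k * k div 4) * n"
    using total handshake[of R, OF sym irr] by simp
  then show ?thesis using G by (intro exI conjI) (assumption, simp add: algebra_simps)
qed

section \<open>Extremal graphs\<close>

lemma circulant_degree:
  fixes D :: "int set"
  assumes "D \<subseteq> {1..<int n}" and x: "x \<in> {1..n}"
  shows "card {y \<in> {1..n}. (int y - int x) mod int n \<in> D} = card D"
proof (rule bij_betw_same_card[of "\<lambda>y. (int y - int x) mod int n"])
  show "bij_betw (\<lambda>y. (int y - int x) mod int n) {y \<in> {1..n}. (int y - int x) mod int n \<in> D} D"
    unfolding bij_betw_def
  proof
    show "inj_on (\<lambda>y. (int y - int x) mod int n) {y \<in> {1..n}. (int y - int x) mod int n \<in> D}"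
    proof (rule inj_onI)
      fix y z assume y: "y \<in> {y \<in> {1..n}. (int y - int x) mod int n \<in> D}"
        and z: "z \<in> {y \<in> {1..n}. (int y - int x) mod int n \<in> D}"
        and eq: "(int y - int x) mod int n = (int z - int x) mod int n"
      from eq have "int n dvd int y - int z" by (simp add: mod_eq_dvd_iff)
      moreover have "\<bar>int y - int z\<bar> < int n" using y z by auto
      ultimately show "y = z" by (metis dvd_imp_le_int eq_iff_diff_eq_0 abs_of_nat not_le of_nat_eq_iff)
    qed
    show "(\<lambda>y. (int y - int x) mod int n) ` {y \<in> {1..n}. (int y - int x) mod int n \<in> D} = D"
    proof
      show "D \<subseteq> (\<lambda>y. (int y - int x) mod int n) ` {y \<in> {1..n}. (int y - int x) mod int n \<in> D}"
      proof
        fix d assume d: "d \<in> D"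
        then have dn: "1 \<le> d" "d < int n" using assms by auto
        define y where "y = nat (if int x + d \<le> int n then int x + d else int x + d - int n)"
        have "y \<in> {1..n}" using dn x by (auto simp: y_def)
        moreover have "(int y - int x) mod int n = d"
        proof (cases "int x + d \<le> int n")
          case True
          then have "int y - int x = d" using dn by (simp add: y_def)
          then show ?thesis using dn by simp
        next
          case False
          then have "int y - int x = d - int n" using dn by (simp add: y_def)
          then show ?thesis using dn by simp
        qed
        ultimately show "d \<in> (\<lambda>y. (int y - int x) mod int n) ` {y \<in> {1..n}. (int y - int x) mod int n \<in> D}"
          using d by (intro image_eqI[of _ _ y]) auto
      qed
    qed auto
  qed
qed

text \<open>A difference set closed under negation modulo \<open>n\<close>: an interval centred at \<open>n / 2\<close>, with the
  midpoint removed when the parity of its size requires it.\<close>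

lemma symmetric_differences:
  assumes "even (r * n)" "r < n"
  obtains D :: "int set" where "D \<subseteq> {1..<int n}" "\<And>d. d \<in> D \<Longrightarrow> int n - d \<in> D" "card D = r"
proof (cases "even (n - 1 - r)")
  case True
  then obtain a where a: "n - 1 - r = 2 * a" by blast
  show ?thesis
  proof
    show "card {int a + 1..int n - 1 - int a} = r" using a assms by simp
  qed (use a assms in auto)
next
  case False
  then have "even n" "even r" using assms by auto
  then obtain a m where a: "n - 2 - r = 2 * a" and m: "n = 2 * m"
    by (metis dvdE dvd_diff_nat even_numeral)
  have le: "r + 2 \<le> n" using \<open>even n\<close> \<open>even r\<close> assms(2) by presburger
  show ?thesis
  proof
    have "int m \<in> {int a + 1..int n - 1 - int a}" using a m le by auto
    then show "card ({int a + 1..int n - 1 - int a} - {int m}) = r" using a le by simp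
  qed (use a m le in auto)
qed

text \<open>A \<open>k / 2\<close>-regular circulant graph.\<close>

lemma even_attains:
  assumes "even k" "4 dvd k * n" "k + 4 \<le> 2 * n"
  shows "\<exists>\<F>. almost_Fisher n k 0 \<F> \<and> k * card \<F> = (k * k div 4 + k) * n + k"
proof -
  obtain r where r: "k = 2 * r" using assms(1) by blast
  have "even (r * n)" using assms(2) r by auto
  moreover have "r < n" using assms(3) r by simp
  ultimately obtain D :: "int set" where D: "D \<subseteq> {1..<int n}"
      "\<And>d. d \<in> D \<Longrightarrow> int n - d \<in> D" "card D = r"
    by (rule symmetric_differences) blast
  let ?R = "\<lambda>x y :: nat. (int y - int x) mod int n \<in> D"
  have deg: "card {y \<in> {1..n}. ?R x y} = r" if "x \<in> {1..n}" for x
    using circulant_degree[OF D(1) that] D(3) by simp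
  show ?thesis
  proof (rule graph_attains[of ?R])
    show "?R y x" if "?R x y" for x y
    proof -
      have "(int x - int y) mod int n = (- (int y - int x)) mod int n" by simp
      also have "\<dots> = int n - (int y - int x) mod int n"
        using that D(1) unfolding zmod_zminus1_eq_if by auto
      finally show ?thesis using D(2)[OF that] by simp
    qed
    show "\<not> ?R x x" for x using D(1) by auto
    show "card {z \<in> {1..n}. ?R x z} + card {z \<in> {1..n}. ?R y z} \<le> k"
      if "x \<in> {1..n}" "y \<in> {1..n}" for x y
      using that by (simp only: deg r)
    show "k * (\<Sum>x\<in>{1..n}. card {y \<in> {1..n}. ?R x y}) = 2 * ((k * k div 4) * n)"
    proof -
      have "(\<Sum>x\<in>{1..n}. card {y \<in> {1..n}. ?R x y}) = (\<Sum>x\<in>{1..n}. r)"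
        by (intro sum.cong refl deg)
      then show ?thesis unfolding r by simp
    qed
  qed
qed

text \<open>Each block of \<open>k\<close> consecutive vertices carries a complete bipartite graph, between the first
  \<open>r = (k - 1) / 2\<close> vertices of the block and the remaining \<open>r + 1\<close>.\<close>

lemma odd_attains:
  assumes "odd k" "k dvd n"
  shows "\<exists>\<F>. almost_Fisher n k 0 \<F> \<and> k * card \<F> = (k * k div 4 + k) * n + k"
proof -
  obtain r where r: "k = 2 * r + 1" using assms(1) by (auto elim: oddE)
  obtain m where m: "n = k * m" using assms(2) by blast
  let ?low = "\<lambda>x. (x - 1) mod k < r"
  let ?R = "\<lambda>x y. (x - 1) div k = (y - 1) div k \<and> ?low x \<noteq> ?low y"
  have deg: "card {y \<in> {1..n}. ?R x y} = (if ?low x then r + 1 else r)" if x: "x \<in> {1..n}" for x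
  proof -
    let ?J = "if ?low x then {r..<k} else {..<r}"
    have "x - 1 < m * k" using x m by (auto simp: mult.commute)
    then have q: "(x - 1) div k < m" by (rule less_mult_imp_div_less)
    have "{y \<in> {1..n}. ?R x y} = (\<lambda>j. Suc ((x - 1) div k * k + j)) ` ?J" 
    proof (intro equalityI subsetI)
      fix y assume y: "y \<in> {y \<in> {1..n}. ?R x y}"
      then have "y = Suc ((x - 1) div k * k + (y - 1) mod k)" by (simp add: div_mult_mod_eq)
      moreover have "(y - 1) mod k \<in> ?J" using y r by auto
      ultimately show "y \<in> (\<lambda>j. Suc ((x - 1) div k * k + j)) ` ?J" by blast
    next
      fix y assume "y \<in> (\<lambda>j. Suc ((x - 1) div k * k + j)) ` ?J"
      then obtain j where j: "j \<in> ?J" "y = Suc ((x - 1) div k * k + j)" by blast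
      have jk: "j < k" using j(1) r by (auto split: if_splits)
      have "(x - 1) div k * k + k \<le> m * k"
        using q by (metis Suc_leI add.commute mult_Suc mult_le_mono1)
      then have "y \<in> {1..n}" using j jk m by (simp add: mult.commute)
      moreover have "(y - 1) div k = (x - 1) div k" "(y - 1) mod k = j" using j jk by simp_all
      ultimately show "y \<in> {y \<in> {1..n}. ?R x y}" using j(1) by (auto split: if_splits)
    qed
    moreover have "inj_on (\<lambda>j. Suc ((x - 1) div k * k + j)) ?J" by (simp add: inj_on_def)
    ultimately show ?thesis using r by (simp add: card_image)
  qed
  have low: "card {x \<in> {1..n}. ?low x} = m * r"
  proof -
    have "card {x \<in> {1..n}. ?low x} = card ({..<m} \<times> {..<r})"
    proof (rule bij_betw_same_card[of "\<lambda>x. ((x - 1) div k, (x - 1) mod k)"],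
        rule bij_betw_byWitness[where f' = "\<lambda>(q, j). Suc (q * k + j)"])
      show "(\<lambda>(q, j). Suc (q * k + j)) ` ({..<m} \<times> {..<r}) \<subseteq> {x \<in> {1..n}. ?low x}"
      proof (rule image_subsetI)
        fix p assume "p \<in> {..<m} \<times> {..<r}"
        then obtain q j where p: "p = (q, j)" and qj: "q < m" "j < r" by auto
        have "q * k + k \<le> m * k"
          using qj by (metis Suc_leI add.commute mult_Suc mult_le_mono1)
        moreover have "j < k" using qj r by simp
        ultimately have "Suc (q * k + j) \<le> n" "(q * k + j) mod k < r"
          using qj m by (simp_all add: mult.commute)
        then show "(\<lambda>(q, j). Suc (q * k + j)) p \<in> {x \<in> {1..n}. ?low x}"
          using p by simp
      qed
    next
      show "(\<lambda>x. ((x - 1) div k, (x - 1) mod k)) ` {x \<in> {1..n}. ?low x} \<subseteq> {..<m} \<times> {..<r}"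
      proof (rule image_subsetI)
        fix x assume x: "x \<in> {x \<in> {1..n}. ?low x}"
        then have "x - 1 < m * k" using m by (auto simp: mult.commute)
        then show "((x - 1) div k, (x - 1) mod k) \<in> {..<m} \<times> {..<r}"
          using x less_mult_imp_div_less by auto
      qed
    next
      show "\<forall>x\<in>{x \<in> {1..n}. ?low x}. (\<lambda>(q, j). Suc (q * k + j)) ((x - 1) div k, (x - 1) mod k) = x"
        by (simp add: div_mult_mod_eq)
    next
      have "j < k" if "j < r" for j using that r by simp
      then show "\<forall>p\<in>{..<m} \<times> {..<r}. (((\<lambda>(q, j). Suc (q * k + j)) p - 1) div k,
          ((\<lambda>(q, j). Suc (q * k + j)) p - 1) mod k) = p"
        by auto
    qed
    then show ?thesis by simp
  qed
  have "(\<Sum>x\<in>{1..n}. card {y \<in> {1..n}. ?R x y}) = (\<Sum>x\<in>{1..n}. r + of_bool (?low x))"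
    using deg by (intro sum.cong) auto
  also have "\<dots> = n * r + card {x \<in> {1..n}. ?low x}"
    by (simp add: sum.distrib of_bool_def sum.If_cases Int_def)
  also have "\<dots> = 2 * (m * (r * r + r))"
    unfolding low unfolding m r by (simp add: algebra_simps)
  finally have total: "(\<Sum>x\<in>{1..n}. card {y \<in> {1..n}. ?R x y}) = 2 * (m * (r * r + r))" .
  have c: "k * k div 4 = r * r + r"
  proof -
    have "k * k = 4 * (r * r + r) + 1" using r by (simp add: algebra_simps)
    then show ?thesis by simp
  qed
  show ?thesis
  proof (rule graph_attains[of ?R])
    show "card {z \<in> {1..n}. ?R x z} + card {z \<in> {1..n}. ?R y z} \<le> k"
      if "x \<in> {1..n}" "y \<in> {1..n}" "?R x y" for x y
      unfolding deg[OF that(1)] deg[OF that(2)] using that(3) r by auto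
    show "k * (\<Sum>x\<in>{1..n}. card {y \<in> {1..n}. ?R x y}) = 2 * ((k * k div 4) * n)"
      unfolding total c unfolding m by (simp add: algebra_simps)
  qed auto
qed


section \<open>The extremal number\<close>

lemma almost_Fisher_card_le:
  assumes "almost_Fisher n k 0 \<F>"
  shows "k * card \<F> \<le> (k * k div 4 + k) * n + k"
proof -
  let ?A = "\<F> - {{}}"
  have sub: "\<F> \<subseteq> Pow {1..n}" using assms by (simp add: almost_Fisher_def)
  have fin: "finite \<F>" using sub by (meson finite_Pow_iff finite_atLeastAtMost finite_subset)
  have "card (touching ?A F) \<le> k + 1" if F: "F \<in> ?A" for F
  proof -
    let ?M = "{F' \<in> \<F> - {F}. card (F \<inter> F') \<noteq> 0}"
    have "finite F" using F sub finite_subset by blast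
    then have "touching ?A F \<subseteq> insert F ?M"
      by (auto simp: touching_def card_eq_0_iff)
    then have "card (touching ?A F) \<le> card (insert F ?M)"
      using fin by (intro card_mono) auto
    also have "\<dots> \<le> card ?M + 1"
      using fin by (simp add: card_insert_if)
    also have "card ?M \<le> k" using assms F by (auto simp: almost_Fisher_def)
    finally show ?thesis by simp
  qed
  then have "k * card ?A \<le> (k * k div 4 + k) * card {1..n}"
    using sub by (intro nonempty_family_bound) auto
  moreover have "card \<F> \<le> card ?A + 1"
    using card_Suc_Diff1[OF fin, of "{}"] by (cases "{} \<in> \<F>") auto
  then have "k * card \<F> \<le> k * (card ?A + 1)" by (rule mult_le_mono2)
  ultimately show ?thesis by simp
qed

theorem mainTheorem2:
  fixes n k :: nat
  assumes "n > 0" and "k > 0"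
    and "(even k \<and> 4 dvd k * n \<and> real n \<ge> real k / 2 + 2) \<or> (odd k \<and> k dvd n)"
  shows "real (max_almost_Fisher n k 0) =
    real n / real k * of_int \<lfloor>(real k)\<^sup>2 / 4\<rfloor> + real n + 1"
proof -
  let ?c = "k * k div 4"
  have "\<exists>\<F>. almost_Fisher n k 0 \<F> \<and> k * card \<F> = (?c + k) * n + k"
    using assms(3)
  proof
    assume "even k \<and> 4 dvd k * n \<and> real n \<ge> real k / 2 + 2"
    moreover then have "k + 4 \<le> 2 * n" by linarith
    ultimately show ?thesis by (intro even_attains) auto
  qed (intro odd_attains; simp)
  then obtain \<F> where F: "almost_Fisher n k 0 \<F>" "k * card \<F> = (?c + k) * n + k" by blast
  have "max_almost_Fisher n k 0 = card \<F>"
    unfolding max_almost_Fisher_def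
  proof (rule Max_eqI)
    fix y assume "y \<in> {card \<G> | \<G>. almost_Fisher n k 0 \<G>}"
    then have "k * y \<le> k * card \<F>" using almost_Fisher_card_le F(2) by auto
    then show "y \<le> card \<F>" using assms(2) by simp
  qed (use finite_card_almost_Fisher F in auto)
  moreover have "real k * real (card \<F>) = (real ?c + real k) * real n + real k"
    using arg_cong[OF F(2), of real] by simp
  moreover have "\<lfloor>(real k)\<^sup>2 / 4\<rfloor> = int ?c"
    using floor_divide_of_nat_eq[of "k * k" 4, where ?'a = real] by (simp add: power2_eq_square)
  ultimately show ?thesis using assms(2) by (simp add: field_simps)
qed

end
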